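(* Let $G$ be a $7$-regular graph and let $uv\in E(G)$ be an edge with exactly four common neighbours, i.e. $|N(u)\cap N(v)|=4$, such that both links $G[N(u)]$ and $G[N(v)]$ are connected and are not weak König–Egerváry graphs. Then the vertex set $\{u,v\}$ is reducible in $G$.
   Context: All graphs are finite, simple and undirected; $N(x)$ is the open neighbourhood of $x$ and $G[W]$ is the subgraph induced by $W\subseteq V(G)$. A graph $H$ is a weak König–Egerváry graph if $H$ has a matching $M$ (possibly empty) and a vertex set $Q\subseteq V(H)$ such that $|Q|\le |M|$ and $Q$ is a vertex cover of $H-M$ (the graph $H$ with the edges of $M$ deleted). For a set $S$ of triangles, an $S$-edge is an edge of some triangle in $S$. A nonempty set $V_0\subseteq V(G)$ is reducible (in $G$) if there exist a set $S$ of pairwise edge-disjoint triangles in $G$ and a set $X$ of edges of $G$ such that: (i) $|X|\le 2|S|$; (ii) $G-X$ has no triangle containing a vertex of $V_0$; and (iii) $X$ contains every $S$-edge whose endpoints are both outside $V_0$. *)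

theory Defs
  imports Main
begin

text \<open>
  A graph is a vertex set together with a set of edges, an edge being the two-element set of
  its endpoints; the cardinality of an edge set is thus the number of undirected edges.
\<close>

record 'a graph =
  verts :: "'a set"
  edges :: "'a set set"

definition simple_graph :: "'a graph \<Rightarrow> bool" where
  "simple_graph G \<longleftrightarrow> finite (verts G) \<and> (\<forall>e \<in> edges G. e \<subseteq> verts G \<and> card e = 2)"

definition nbhd :: "'a graph \<Rightarrow> 'a \<Rightarrow> 'a set" where
  "nbhd G x = {y \<in> verts G. {x, y} \<in> edges G}"

definition regular :: "nat \<Rightarrow> 'a graph \<Rightarrow> bool" where
  "regular d G \<longleftrightarrow> (\<forall>x \<in> verts G. card (nbhd G x) = d)"

definition induced :: "'a graph \<Rightarrow> 'a set \<Rightarrow> 'a graph" where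
  "induced G W = \<lparr>verts = W, edges = {e \<in> edges G. e \<subseteq> W}\<rparr>"

definition del_edges :: "'a graph \<Rightarrow> 'a set set \<Rightarrow> 'a graph" where
  "del_edges G X = \<lparr>verts = verts G, edges = edges G - X\<rparr>"

definition connected_graph :: "'a graph \<Rightarrow> bool" where
  "connected_graph G \<longleftrightarrow> verts G \<noteq> {} \<and>
     (\<forall>x \<in> verts G. \<forall>y \<in> verts G. (x, y) \<in> {(a, b). {a, b} \<in> edges G}\<^sup>*)"

definition matching :: "'a graph \<Rightarrow> 'a set set \<Rightarrow> bool" where
  "matching G M \<longleftrightarrow> M \<subseteq> edges G \<and> pairwise disjnt M"

definition vertex_cover :: "'a graph \<Rightarrow> 'a set \<Rightarrow> bool" where
  "vertex_cover G Q \<longleftrightarrow> Q \<subseteq> verts G \<and> (\<forall>e \<in> edges G. e \<inter> Q \<noteq> {})"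

definition weak_konig_egervary :: "'a graph \<Rightarrow> bool" where
  "weak_konig_egervary H \<longleftrightarrow>
     (\<exists>M Q. matching H M \<and> vertex_cover (del_edges H M) Q \<and> card Q \<le> card M)"

text \<open>In a simple graph a triangle is determined by its three vertices, so it is
  represented by its vertex set.\<close>

definition triangle :: "'a graph \<Rightarrow> 'a set \<Rightarrow> bool" where
  "triangle G T \<longleftrightarrow> T \<subseteq> verts G \<and> card T = 3 \<and>
     (\<forall>x \<in> T. \<forall>y \<in> T. x \<noteq> y \<longrightarrow> {x, y} \<in> edges G)"

definition triangle_edges :: "'a set \<Rightarrow> 'a set set" where
  "triangle_edges T = {{x, y} |x y. x \<in> T \<and> y \<in> T \<and> x \<noteq> y}"

definition reducible :: "'a graph \<Rightarrow> 'a set \<Rightarrow> bool" where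
  "reducible G V\<^sub>0 \<longleftrightarrow> V\<^sub>0 \<noteq> {} \<and> V\<^sub>0 \<subseteq> verts G \<and>
     (\<exists>S X. (\<forall>T \<in> S. triangle G T) \<and>
            pairwise (\<lambda>T T'. disjnt (triangle_edges T) (triangle_edges T')) S \<and>
            X \<subseteq> edges G \<and>
            card X \<le> 2 * card S \<and>
            \<not> (\<exists>T. triangle (del_edges G X) T \<and> T \<inter> V\<^sub>0 \<noteq> {}) \<and>
            (\<forall>e \<in> \<Union> (triangle_edges ` S). e \<inter> V\<^sub>0 = {} \<longrightarrow> e \<in> X))"

end

theory Submission
  imports Defs
begin

text \<open>
  Let \<open>C = N(u) \<inter> N(v) = {c1, c2, c3, c4}\<close>, \<open>N(u) = {v} \<union> C \<union> {a1, a2}\<close> and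
  \<open>N(v) = {u} \<union> C \<union> {b1, b2}\<close>. Only the 24 adjacencies inside \<open>C \<union> {a1, a2}\<close> and inside
  \<open>C \<union> {b1, b2}\<close> lie in triangles through \<open>u\<close> or \<open>v\<close>. Each matching and each vertex set of
  suitable size witnesses that some further adjacency is present, since the links are not weak
  Koenig--Egervary; each packing of triangles through \<open>u\<close> and \<open>v\<close> with a cheap enough set of
  deleted edges does the same if \<open>{u, v}\<close> is irreducible; and vertices of \<open>C\<close> have degree
  at most 7. A few such constraints, taken under all relabellings that preserve
  \<open>C\<close>, \<open>{a1, a2}\<close>, \<open>{b1, b2}\<close> or exchange the two sides, are propositionally inconsistent.
\<close>

section \<open>Edges and links of simple graphs\<close>

lemma simple_graph_edgeE:
  assumes "simple_graph G" "e \<in> edges G"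
  obtains x y where "e = {x, y}" "x \<noteq> y" "x \<in> verts G" "y \<in> verts G"
proof -
  have "card e = 2" "e \<subseteq> verts G"
    using assms by (auto simp: simple_graph_def)
  then show ?thesis
    using that by (auto simp: card_2_iff)
qed

lemma simple_graph_edgeD:
  assumes "simple_graph G" "{x, y} \<in> edges G"
  shows "x \<noteq> y" "x \<in> verts G" "y \<in> verts G"
  using simple_graph_edgeE[OF assms] by (metis doubleton_eq_iff)+

lemma mem_nbhd_iff:
  assumes "simple_graph G"
  shows "y \<in> nbhd G x \<longleftrightarrow> {x, y} \<in> edges G"
  using simple_graph_edgeD[OF assms] by (auto simp: nbhd_def)

lemma simple_graph_finite_edges:
  assumes "simple_graph G"
  shows "finite (edges G)"
  using assms by (auto simp: simple_graph_def intro: finite_subset[of _ "Pow (verts G)"])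

text \<open>If every edge inside \<open>W\<close> that avoids \<open>Q\<close> belonged to
  \<open>M\<close>, then \<open>Q\<close> would cover what remains after deleting \<open>M\<close>,
  and \<open>M\<close>, \<open>Q\<close> would be a witness. Each choice of \<open>M\<close> and
  \<open>Q\<close> therefore forces one further edge.\<close>

lemma not_weak_konig_egervaryD:
  assumes "simple_graph G" "\<not> weak_konig_egervary (induced G W)"
    and "M \<subseteq> edges G" "\<Union>M \<subseteq> W" "pairwise disjnt M" "Q \<subseteq> W" "card Q \<le> card M"
  shows "\<exists>x \<in> W - Q. \<exists>y \<in> W - Q. x \<noteq> y \<and> {x, y} \<in> edges G - M"
proof (rule ccontr)
  assume none: "\<not> ?thesis"
  have "matching (induced G W) M"
    using assms by (auto simp: matching_def induced_def)
  moreover have "e \<inter> Q \<noteq> {}" if "e \<in> edges G" "e \<subseteq> W" "e \<notin> M" for e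
  proof -
    obtain x y where "e = {x, y}" "x \<noteq> y"
      using simple_graph_edgeE[OF assms(1) \<open>e \<in> edges G\<close>] by metis
    then show ?thesis
      using that none by blast
  qed
  then have "vertex_cover (del_edges (induced G W) M) Q"
    using assms by (auto simp: vertex_cover_def del_edges_def induced_def)
  ultimately show False
    using assms unfolding weak_konig_egervary_def by blast
qed

section \<open>Edge-disjoint triangles through two adjacent vertices\<close>

text \<open>A shared edge would have two distinct endpoints in \<open>T \<inter> T'\<close>.\<close>

lemma disjnt_triangle_edges:
  assumes "\<And>x y. x \<in> T \<inter> T' \<Longrightarrow> y \<in> T \<inter> T' \<Longrightarrow> x = y"
  shows "disjnt (triangle_edges T) (triangle_edges T')"
proof -
  have "x = y" if "{x, y} = {x', y'}" "x \<in> T" "y \<in> T" "x' \<in> T'" "y' \<in> T'" for x y x' y'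
    using that by (intro assms) (auto simp: doubleton_eq_iff)
  then show ?thesis
    unfolding disjnt_def triangle_edges_def by blast
qed

lemma triangle_insertI:
  assumes G: "simple_graph G" and e: "e \<in> edges G" "e \<subseteq> nbhd G w"
  shows "triangle G (insert w e)"
proof -
  obtain x y where "e = {x, y}" "x \<noteq> y"
    using simple_graph_edgeE[OF G e(1)] by metis
  moreover have "{w, x} \<in> edges G" "{w, y} \<in> edges G"
    using e(2) \<open>e = {x, y}\<close> by (auto simp: nbhd_def)
  moreover note simple_graph_edgeD[OF G this(1)] simple_graph_edgeD[OF G this(2)]
  ultimately show ?thesis
    using e(1) by (auto simp: triangle_def insert_commute)
qed

lemma card_3_memE:
  assumes "card T = 3" "w \<in> T"
  obtains x y where "T = {w, x, y}" "x \<noteq> y" "x \<noteq> w" "y \<noteq> w"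
proof -
  have "card (T - {w}) = 2"
    using assms by simp
  then obtain x y where "T - {w} = {x, y}" "x \<noteq> y"
    by (auto simp: card_2_iff)
  with assms(2) that show ?thesis
    by blast
qed

text \<open>The packing consists of the triangles spanned by \<open>u\<close> and an edge of \<open>Mu\<close>, by \<open>v\<close> and
  an edge of \<open>Mv\<close>, and by \<open>u\<close>, \<open>v\<close> and the vertex of \<open>T\<close>, if any. The deleted edges are those
  from \<open>u\<close> to \<open>Qu\<close> and from \<open>v\<close> to \<open>Qv\<close>, together with \<open>Mu\<close>, \<open>Mv\<close> and \<open>F\<close>.\<close>

lemma reducible_pairI:
  assumes G: "simple_graph G" and uv: "{u, v} \<in> edges G"
    and Mu: "Mu \<subseteq> edges G" "\<Union>Mu \<subseteq> nbhd G u - {v}" "pairwise disjnt Mu"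
    and Mv: "Mv \<subseteq> edges G" "\<Union>Mv \<subseteq> nbhd G v - {u}" "pairwise disjnt Mv"
    and MuMv: "Mu \<inter> Mv = {}"
    and T: "T \<subseteq> nbhd G u \<inter> nbhd G v" "T \<inter> \<Union>(Mu \<union> Mv) = {}" "card T \<le> 1" "finite T"
    and fin: "finite Qu" "finite Qv" "finite F"
    and card: "card Qu + card Qv + card Mu + card Mv + card F \<le> 2 * (card Mu + card Mv + card T)"
    and cover_u: "\<And>x y. \<lbrakk>x \<in> nbhd G u - insert v Qu; y \<in> nbhd G u - insert v Qu; x \<noteq> y;
        {x, y} \<in> edges G\<rbrakk> \<Longrightarrow> {x, y} \<in> Mu \<union> Mv \<union> F"
    and cover_v: "\<And>x y. \<lbrakk>x \<in> nbhd G v - insert u Qv; y \<in> nbhd G v - insert u Qv; x \<noteq> y;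
        {x, y} \<in> edges G\<rbrakk> \<Longrightarrow> {x, y} \<in> Mu \<union> Mv \<union> F"
    and cover_uv: "v \<in> Qu \<or> nbhd G u \<inter> nbhd G v \<subseteq> Qu \<union> Qv"
  shows "reducible G {u, v}"
proof -
  define S where "S = insert u ` Mu \<union> insert v ` Mv \<union> (\<lambda>c. {u, v, c}) ` T"
  \<comment> \<open>The intersection secures \<open>X \<subseteq> edges G\<close> although
    \<open>F\<close> may contain non-edges and \<open>Qu\<close>, \<open>Qv\<close>
    non-neighbours.\<close>
  define X where "X = edges G \<inter> ((\<lambda>x. {u, x}) ` Qu \<union> (\<lambda>x. {v, x}) ` Qv \<union> Mu \<union> Mv \<union> F)"
  note nb = mem_nbhd_iff[OF G]
  have uv': "u \<noteq> v" "u \<in> verts G" "v \<in> verts G"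
    using simple_graph_edgeD[OF G uv] by auto
  have notin: "u \<notin> nbhd G u" "v \<notin> nbhd G v"
    using simple_graph_edgeD(1)[OF G, of u u] simple_graph_edgeD(1)[OF G, of v v]
    by (auto simp: nb)
  have out: "u \<notin> e" "v \<notin> e" if "e \<in> Mu \<union> Mv" for e
    using that Mu(2) Mv(2) notin by auto
  have uT: "u \<notin> T" "v \<notin> T"
    using T(1) notin by auto
  have finM: "finite Mu" "finite Mv"
    using Mu(1) Mv(1) simple_graph_finite_edges[OF G] finite_subset by auto
  have two: "e = {x, y}" if "e \<in> Mu \<union> Mv" "x \<in> e" "y \<in> e" "x \<noteq> y" for e x y
    using that Mu(1) Mv(1) by (auto elim!: simple_graph_edgeE[OF G, of e])

  have "card (insert u ` Mu) = card Mu" "card (insert v ` Mv) = card Mv"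
    using out by (auto intro!: card_image inj_onI dest!: insert_ident[THEN iffD1, rotated 2])
  moreover have "card ((\<lambda>c. {u, v, c}) ` T) = card T"
    using uT by (auto intro!: card_image inj_onI simp: insert_eq_iff)
  \<comment> \<open>The three kinds of triangle meet \<open>{u, v}\<close> in \<open>{u}\<close>, in
    \<open>{v}\<close> and in \<open>{u, v}\<close>, so triangles of different kinds never
    coincide.\<close>
  moreover have "insert u ` Mu \<inter> insert v ` Mv = {}"
    using out uv' by blast
  moreover have "(insert u ` Mu \<union> insert v ` Mv) \<inter> (\<lambda>c. {u, v, c}) ` T = {}"
  proof -
    have "insert u e \<noteq> {u, v, c}" if "e \<in> Mu" for e c
      using out[of e] that uv'(1) by (metis UnI1 insertCI insertE)
    moreover have "insert v e \<noteq> {u, v, c}" if "e \<in> Mv" for e c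
      using out[of e] that uv'(1) by (metis UnI2 insertCI insertE)
    ultimately show ?thesis
      by blast
  qed
  ultimately have card_S: "card S = card Mu + card Mv + card T"
    unfolding S_def using finM T(4) by (simp add: card_Un_disjoint)

  have "card X \<le> card ((\<lambda>x. {u, x}) ` Qu \<union> (\<lambda>x. {v, x}) ` Qv \<union> Mu \<union> Mv \<union> F)"
    unfolding X_def using fin finM by (intro card_mono) auto
  also have "\<dots> \<le> card ((\<lambda>x. {u, x}) ` Qu) + card ((\<lambda>x. {v, x}) ` Qv) + card Mu + card Mv + card F"
    by (intro order_trans[OF card_Un_le] add_mono order_refl)
  also have "\<dots> \<le> card Qu + card Qv + card Mu + card Mv + card F"
    using fin by (intro add_mono order_refl card_image_le) auto
  finally have card_X: "card X \<le> 2 * card S"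
    using card by (simp add: card_S)

  have "triangle G t" if "t \<in> S" for t
  proof -
    have "triangle G (insert u e)" if "e \<in> Mu" for e
      using that Mu(1,2) by (intro triangle_insertI[OF G]) auto
    moreover have "triangle G (insert v e)" if "e \<in> Mv" for e
      using that Mv(1,2) by (intro triangle_insertI[OF G]) auto
    moreover have "triangle G {u, v, c}" if "c \<in> T" for c
      using that T(1) uv by (intro triangle_insertI[OF G]) (auto simp: nb)
    ultimately show ?thesis
      using that unfolding S_def by blast
  qed
  moreover have "pairwise (\<lambda>t t'. disjnt (triangle_edges t) (triangle_edges t')) S"
  proof -
    have sym: "disjnt (triangle_edges t') (triangle_edges t)"
      if "disjnt (triangle_edges t) (triangle_edges t')" for t t' :: "'a set"
      using that by (simp add: disjnt_sym)
    have uu: "disjnt (triangle_edges (insert u e)) (triangle_edges (insert u e'))"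
      if "e \<in> Mu" "e' \<in> Mu" "insert u e \<noteq> insert u e'" for e e'
    proof -
      have "e \<inter> e' = {}"
        using that Mu(3) by (metis disjnt_def pairwiseD)
      then show ?thesis
        by (intro disjnt_triangle_edges) auto
    qed
    have vv: "disjnt (triangle_edges (insert v e)) (triangle_edges (insert v e'))"
      if "e \<in> Mv" "e' \<in> Mv" "insert v e \<noteq> insert v e'" for e e'
    proof -
      have "e \<inter> e' = {}"
        using that Mv(3) by (metis disjnt_def pairwiseD)
      then show ?thesis
        by (intro disjnt_triangle_edges) auto
    qed
    \<comment> \<open>Common vertices of the two triangles lie in \<open>e \<inter> e'\<close>, and
      two of them would force \<open>e = e'\<close>. So \<open>Mu\<close> and \<open>Mv\<close> may
      share vertices but not edges.\<close>
    have uv: "disjnt (triangle_edges (insert u e)) (triangle_edges (insert v e'))"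
      if "e \<in> Mu" "e' \<in> Mv" for e e'
    proof (rule disjnt_triangle_edges, rule ccontr)
      fix x y
      assume "x \<in> insert u e \<inter> insert v e'" "y \<in> insert u e \<inter> insert v e'" "x \<noteq> y"
      moreover from this have "x \<in> e \<inter> e'" "y \<in> e \<inter> e'"
        using that out uv'(1) by auto
      ultimately have "e = e'"
        using two that by (metis IntD1 IntD2 UnCI)
      then show False
        using that MuMv by auto
    qed
    have ut: "disjnt (triangle_edges (insert u e)) (triangle_edges {u, v, c})"
      if "e \<in> Mu" "c \<in> T" for e c
      using that out T(2) by (intro disjnt_triangle_edges) auto
    have vt: "disjnt (triangle_edges (insert v e)) (triangle_edges {u, v, c})"
      if "e \<in> Mv" "c \<in> T" for e c
      using that out T(2) by (intro disjnt_triangle_edges) auto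
    have tt: "c = d" if "c \<in> T" "d \<in> T" for c d
      using that T(3,4) by (simp add: card_le_Suc0_iff_eq)
    show ?thesis
    proof (rule pairwiseI)
      fix t t'
      assume "t \<in> S" "t' \<in> S" "t \<noteq> t'"
      then show "disjnt (triangle_edges t) (triangle_edges t')"
        unfolding S_def
        by (elim UnE imageE)
          (auto intro: uu vv uv ut vt uv[THEN sym] ut[THEN sym] vt[THEN sym] dest: tt)
    qed
  qed
  moreover have "\<not> (\<exists>t. triangle (del_edges G X) t \<and> t \<inter> {u, v} \<noteq> {})"
  proof
    assume "\<exists>t. triangle (del_edges G X) t \<and> t \<inter> {u, v} \<noteq> {}"
    then obtain t where tri: "triangle (del_edges G X) t" and t: "card t = 3" "t \<inter> {u, v} \<noteq> {}"
      by (auto simp: triangle_def)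
    have edge: "{x, y} \<in> edges G" "{x, y} \<notin> X" if "x \<in> t" "y \<in> t" "x \<noteq> y" for x y
      using tri that by (auto simp: triangle_def del_edges_def)
    have notQ: "x \<notin> Qu" if "u \<in> t" "x \<in> t" "x \<noteq> u" for x
      using edge[of u x] that by (auto simp: X_def)
    have notQ': "x \<notin> Qv" if "v \<in> t" "x \<in> t" "x \<noteq> v" for x
      using edge[of v x] that by (auto simp: X_def)
    \<comment> \<open>Triangles on the edge \<open>uv\<close> are handled by
      \<open>cover_uv\<close>. Any other triangle consists of one endpoint and an edge of its link
      avoiding the other endpoint, which is why \<open>cover_u\<close> leaves out \<open>v\<close>
      and \<open>cover_v\<close> leaves out \<open>u\<close>.\<close>
    consider "u \<in> t" "v \<in> t" | "u \<in> t" "v \<notin> t" | "u \<notin> t" "v \<in> t"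
      using t(2) by auto
    then show False
    proof cases
      case 1
      have "\<not> t \<subseteq> {u, v}"
        using t(1) card_mono[of "{u, v}" t] uv'(1) by auto
      then obtain c where c: "c \<in> t" "c \<noteq> u" "c \<noteq> v"
        by auto
      then have "c \<in> nbhd G u \<inter> nbhd G v"
        using edge(1)[of u c] edge(1)[of v c] 1 by (simp add: nb)
      then show False
        using cover_uv notQ[OF 1(1)] notQ'[OF 1(2)] 1 c uv'(1) by blast
    next
      case 2
      obtain x y where t_eq: "t = {u, x, y}" "x \<noteq> y" "x \<noteq> u" "y \<noteq> u"
        using card_3_memE[OF t(1) 2(1)] by metis
      have "x \<in> nbhd G u - insert v Qu" "y \<in> nbhd G u - insert v Qu"
        using edge(1)[of u x] edge(1)[of u y] notQ[of x] notQ[of y] t_eq 2 by (auto simp: nb)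
      then show False
        using cover_u[of x y] edge[of x y] t_eq by (auto simp: X_def)
    next
      case 3
      obtain x y where t_eq: "t = {v, x, y}" "x \<noteq> y" "x \<noteq> v" "y \<noteq> v"
        using card_3_memE[OF t(1) 3(2)] by metis
      have "x \<in> nbhd G v - insert u Qv" "y \<in> nbhd G v - insert u Qv"
        using edge(1)[of v x] edge(1)[of v y] notQ'[of x] notQ'[of y] t_eq 3 by (auto simp: nb)
      then show False
        using cover_v[of x y] edge[of x y] t_eq by (auto simp: X_def)
    qed
  qed
  \<comment> \<open>An edge of a packed triangle that avoids \<open>u\<close> and \<open>v\<close>
    can only come from \<open>Mu\<close> or \<open>Mv\<close>, and these are deleted in
    full.\<close>
  moreover have "\<forall>e \<in> \<Union>(triangle_edges ` S). e \<inter> {u, v} = {} \<longrightarrow> e \<in> X"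
  proof (intro ballI impI)
    fix e
    assume "e \<in> \<Union>(triangle_edges ` S)" and e: "e \<inter> {u, v} = {}"
    then obtain t x y where t: "t \<in> S" "e = {x, y}" "x \<in> t" "y \<in> t" "x \<noteq> y"
      by (auto simp: triangle_edges_def)
    have xy: "x \<noteq> u" "x \<noteq> v" "y \<noteq> u" "y \<noteq> v"
      using e t(2) by auto
    then obtain f where "f \<in> Mu \<union> Mv" "x \<in> f" "y \<in> f"
      using t unfolding S_def by auto
    then have "e \<in> Mu \<union> Mv"
      using two[of f x y] t by simp
    then show "e \<in> X"
      using Mu(1) Mv(1) by (auto simp: X_def)
  qed
  ultimately show ?thesis
    unfolding reducible_def using card_X uv'
    by (intro conjI exI[of _ S] exI[of _ X]) (auto simp: X_def)
qed

section \<open>Propositional constraints on the adjacencies\<close>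

text \<open>The constraints, up to relabelling, were found by computer search: starting from the degree
  and link constraints, a packing was added for each remaining pattern of adjacencies, and
  redundant constraints were dropped afterwards.\<close>

definition forced_in_link ::
  "('a \<Rightarrow> 'a \<Rightarrow> bool) \<Rightarrow> 'a \<Rightarrow> 'a \<Rightarrow> 'a \<Rightarrow> 'a \<Rightarrow> 'a \<Rightarrow> 'a \<Rightarrow> bool" where
  "forced_in_link adj c1 c2 c3 c4 a1 a2 \<longleftrightarrow>
    (adj c3 c4 \<and> adj a1 a2 \<longrightarrow> adj c2 a1 \<or> adj c2 a2) \<and>
    (adj c1 c2 \<and> adj c3 a1 \<longrightarrow> adj c4 a1 \<or> adj c4 a2 \<or> adj a1 a2) \<and>
    (adj c1 a1 \<and> adj c3 a2 \<longrightarrow> adj c4 a1 \<or> adj c4 a2 \<or> adj a1 a2) \<and>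
    (adj c1 c4 \<and> adj c3 a1 \<longrightarrow> adj c1 c3 \<or> adj c1 a1 \<or> adj c3 c4 \<or> adj c4 a1) \<and>
    (adj c1 c3 \<and> adj c4 a2 \<longrightarrow> adj c1 c4 \<or> adj c1 a1 \<or> adj c3 c4 \<or> adj c3 a1 \<or> adj c4 a1) \<and>
    (adj c3 a2 \<and> adj c4 a1 \<longrightarrow>
      adj c1 c2 \<or> adj c1 c3 \<or> adj c1 c4 \<or> adj c2 c3 \<or> adj c2 c4 \<or> adj c3 c4) \<and>
    (adj c2 a2 \<longrightarrow>
      adj c1 c2 \<or> adj c1 c3 \<or> adj c1 a1 \<or> adj c1 a2 \<or> adj c2 c3 \<or>
      adj c2 a1 \<or> adj c3 a1 \<or> adj c3 a2 \<or> adj a1 a2) \<and>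
    (adj a1 a2 \<longrightarrow>
      adj c1 c3 \<or> adj c1 c4 \<or> adj c1 a1 \<or> adj c1 a2 \<or> adj c3 c4 \<or>
      adj c3 a1 \<or> adj c3 a2 \<or> adj c4 a1 \<or> adj c4 a2) \<and>
    (adj c3 a2 \<longrightarrow>
      adj c1 c2 \<or> adj c1 c4 \<or> adj c1 a1 \<or> adj c1 a2 \<or> adj c2 c4 \<or>
      adj c2 a1 \<or> adj c2 a2 \<or> adj c4 a1 \<or> adj c4 a2 \<or> adj a1 a2) \<and>
    (adj c2 a1 \<longrightarrow>
      adj c1 c2 \<or> adj c1 c3 \<or> adj c1 c4 \<or> adj c1 a2 \<or> adj c2 c3 \<or>
      adj c2 c4 \<or> adj c2 a2 \<or> adj c3 c4 \<or> adj c3 a2 \<or> adj c4 a2) \<and>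
    (adj c1 a1 \<or> adj c1 a2 \<or> adj c2 a1 \<or> adj c2 a2 \<or>
      adj c3 a1 \<or> adj c3 a2 \<or> adj c4 a1 \<or> adj c4 a2)"

definition forced_in_pair ::
  "('a \<Rightarrow> 'a \<Rightarrow> bool) \<Rightarrow> 'a \<Rightarrow> 'a \<Rightarrow> 'a \<Rightarrow> 'a \<Rightarrow> 'a \<Rightarrow> 'a \<Rightarrow> 'a \<Rightarrow> 'a \<Rightarrow> bool" where
  "forced_in_pair adj c1 c2 c3 c4 a1 a2 b1 b2 \<longleftrightarrow>
    (\<not> (adj c1 c2 \<and> adj c1 c3 \<and> adj c1 c4 \<and> adj c1 a1 \<and> adj c1 a2 \<and> adj c1 b1)) \<and>
    (\<not> (adj c1 c2 \<and> adj c1 c3 \<and> adj c1 a1 \<and> adj c1 a2 \<and> adj c1 b1 \<and> adj c1 b2)) \<and>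
    (adj c1 c2 \<and> adj c2 a1 \<and> adj c3 a2 \<and> adj c3 b1 \<longrightarrow> adj c1 a1 \<or> adj c3 c4 \<or> adj c4 b1) \<and>
    (adj c1 c3 \<and> adj c1 b1 \<and> adj c4 a2 \<and> adj c4 b2 \<longrightarrow>
      adj c1 c2 \<or> adj c1 c4 \<or> adj c2 c3 \<or> adj c3 c4) \<and>
    (adj c1 c2 \<and> adj c1 a1 \<and> adj c2 c3 \<and> adj c3 b2 \<longrightarrow>
      adj c1 c3 \<or> adj c1 a2 \<or> adj c2 a2 \<or> adj c3 a2) \<and>
    (adj c1 c2 \<and> adj c1 a2 \<and> adj c2 a1 \<and> adj c3 c4 \<and> adj c3 b1 \<and> adj c4 b2 \<longrightarrow>
      adj c1 a1 \<or> adj c3 b2) \<and>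
    (adj c1 c2 \<and> adj c1 c3 \<and> adj c2 c4 \<and> adj c3 c4 \<and> adj b1 b2 \<longrightarrow> adj c1 c4 \<or> adj c2 c3) \<and>
    (adj c2 c4 \<and> adj c2 a2 \<and> adj c3 c4 \<and> adj c3 b1 \<longrightarrow> adj c1 c2 \<or> adj c1 c3 \<or> adj c2 c3) \<and>
    (adj c2 c4 \<and> adj c2 a1 \<and> adj c3 c4 \<and> adj c3 b1 \<longrightarrow>
      adj c2 a2 \<or> adj c2 b2 \<or> adj c3 a2 \<or> adj c3 b2 \<or> adj c4 a2 \<or> adj c4 b2) \<and>
    (adj c2 c3 \<and> adj c2 b1 \<and> adj c3 b2 \<and> adj c4 a1 \<longrightarrow> adj c2 b2 \<or> adj c3 b1 \<or> adj b1 b2) \<and>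
    (adj c2 c3 \<and> adj c2 a1 \<and> adj c3 c4 \<and> adj c4 b2 \<longrightarrow> adj c1 c3 \<or> adj c1 c4 \<or> adj c2 c4) \<and>
    (adj c2 c3 \<and> adj c2 a2 \<and> adj c3 c4 \<and> adj c4 b1 \<longrightarrow>
      adj c2 a1 \<or> adj c2 b1 \<or> adj c3 a1 \<or> adj c3 b1 \<or> adj c4 a1)"

text \<open>There are 24 unknowns: six pairs among the \<open>c\<close>'s, sixteen pairs joining a
  \<open>c\<close> to an \<open>a\<close> or a \<open>b\<close>, and the pairs \<open>a1 a2\<close>
  and \<open>b1 b2\<close>. Once the quantifiers are expanded, the hypotheses are finitely many
  propositional formulas, refuted by a SAT solver.\<close>

lemma forced_adjacencies_inconsistent:
  fixes adj :: "'a \<Rightarrow> 'a \<Rightarrow> bool"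
  assumes sym: "\<And>x y. adj x y \<longleftrightarrow> adj y x"
    and distinct: "distinct [c1, c2, c3, c4, a1, a2, b1, b2]"
    and link_a: "\<forall>w \<in> {c1, c2, c3, c4}. \<forall>x \<in> {c1, c2, c3, c4} - {w}.
      \<forall>y \<in> {c1, c2, c3, c4} - {w, x}. \<forall>z \<in> {c1, c2, c3, c4} - {w, x, y}.
      \<forall>p \<in> {a1, a2}. \<forall>q \<in> {a1, a2} - {p}. forced_in_link adj w x y z p q"
    and link_b: "\<forall>w \<in> {c1, c2, c3, c4}. \<forall>x \<in> {c1, c2, c3, c4} - {w}.
      \<forall>y \<in> {c1, c2, c3, c4} - {w, x}. \<forall>z \<in> {c1, c2, c3, c4} - {w, x, y}.
      \<forall>r \<in> {b1, b2}. \<forall>s \<in> {b1, b2} - {r}. forced_in_link adj w x y z r s"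
    and pair: "\<forall>w \<in> {c1, c2, c3, c4}. \<forall>x \<in> {c1, c2, c3, c4} - {w}.
      \<forall>y \<in> {c1, c2, c3, c4} - {w, x}. \<forall>z \<in> {c1, c2, c3, c4} - {w, x, y}.
      \<forall>p \<in> {a1, a2}. \<forall>q \<in> {a1, a2} - {p}. \<forall>r \<in> {b1, b2}. \<forall>s \<in> {b1, b2} - {r}.
      forced_in_pair adj w x y z p q r s \<and> forced_in_pair adj w x y z r s p q"
  shows False
proof -
  \<comment> \<open>Reversing the list supplies every disequality in the opposite orientation for
    rewriting.\<close>
  have "distinct [b2, b1, a2, a1, c4, c3, c2, c1]"
    using distinct by (simp add: eq_commute)
  note neq = distinct[simplified] this[simplified]
  \<comment> \<open>Mixed pairs always have the \<open>c\<close> first in the constraints, so only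
    pairs within one class need a normal form.\<close>
  have comm: "adj c2 c1 = adj c1 c2" "adj c3 c1 = adj c1 c3" "adj c4 c1 = adj c1 c4"
    "adj c3 c2 = adj c2 c3" "adj c4 c2 = adj c2 c4" "adj c4 c3 = adj c3 c4"
    "adj a2 a1 = adj a1 a2" "adj b2 b1 = adj b1 b2"
    by (rule sym)+
  \<comment> \<open>Distinctness evaluates set differences between explicit sets, so the bounded
    quantifiers become finite conjunctions.\<close>
  note expand = neq insert_Diff_if ball_simps insert_iff empty_iff if_True if_False simp_thms
    empty_Diff
  show False
    using link_a[simplified expand, unfolded forced_in_link_def comm]
      link_b[simplified expand, unfolded forced_in_link_def comm]
      pair[simplified expand, unfolded forced_in_pair_def comm]
    by sat
qed

section \<open>Labelled neighbourhoods of an irreducible edge\<close>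

locale irreducible_edge =
  fixes G :: "'a graph" and u v c1 c2 c3 c4 a1 a2 b1 b2 :: 'a
  assumes simple: "simple_graph G"
    and seven_regular: "regular 7 G"
    and distinct: "distinct [u, v, c1, c2, c3, c4, a1, a2, b1, b2]"
    and nbhd_u: "nbhd G u = {v, c1, c2, c3, c4, a1, a2}"
    and nbhd_v: "nbhd G v = {u, c1, c2, c3, c4, b1, b2}"
    and connected_u: "connected_graph (induced G (nbhd G u))"
    and connected_v: "connected_graph (induced G (nbhd G v))"
    and not_weak_ke_u: "\<not> weak_konig_egervary (induced G (nbhd G u))"
    and not_weak_ke_v: "\<not> weak_konig_egervary (induced G (nbhd G v))"
    and irreducible: "\<not> reducible G {u, v}"
begin

text \<open>With these rules all adjacencies at \<open>u\<close> and \<open>v\<close> are decided,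
  so checking a certificate leaves open only those among the other eight vertices.\<close>

lemma adjacent_u [simp]: "{u, x} \<in> edges G \<longleftrightarrow> x \<in> {v, c1, c2, c3, c4, a1, a2}"
  using mem_nbhd_iff[OF simple, of x u] nbhd_u by simp

lemma adjacent_v [simp]: "{v, x} \<in> edges G \<longleftrightarrow> x \<in> {u, c1, c2, c3, c4, b1, b2}"
  using mem_nbhd_iff[OF simple, of x v] nbhd_v by simp

lemma adjacent_u' [simp]: "{x, u} \<in> edges G \<longleftrightarrow> x \<in> {v, c1, c2, c3, c4, a1, a2}"
  using adjacent_u[of x] by (simp add: insert_commute[of x])

lemma adjacent_v' [simp]: "{x, v} \<in> edges G \<longleftrightarrow> x \<in> {u, c1, c2, c3, c4, b1, b2}"
  using adjacent_v[of x] by (simp add: insert_commute[of x])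

lemma distinct_vertices_rev: "distinct [b2, b1, a2, a1, c4, c3, c2, c1, v, u]"
  using distinct by (simp add: eq_commute)

lemmas [simp] = distinct_vertices_rev[unfolded distinct.simps list.set, simplified]

lemmas [simp] = distinct[unfolded distinct.simps list.set, simplified]

lemmas certificate_simps =
  insert_commute insert_Diff_if pairwise_insert doubleton_eq_iff card_insert_if

text \<open>\<open>M\<close> and \<open>Q\<close> act as a certificate: with quantifiers over
  explicit sets, the covering condition is checked pair by pair. The link of \<open>v\<close> is
  reached through \<open>swap\<close>.\<close>

lemma uncovered:
  assumes "M \<subseteq> edges G" "\<Union>M \<subseteq> {v, c1, c2, c3, c4, a1, a2}" "pairwise disjnt M"
    and "Q \<subseteq> {v, c1, c2, c3, c4, a1, a2}" "card Q \<le> card M"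
    and "\<forall>x \<in> {v, c1, c2, c3, c4, a1, a2} - Q. \<forall>y \<in> {v, c1, c2, c3, c4, a1, a2} - Q.
      x \<noteq> y \<longrightarrow> {x, y} \<in> edges G \<longrightarrow> {x, y} \<in> M"
  shows False
proof -
  have "\<exists>x \<in> {v, c1, c2, c3, c4, a1, a2} - Q. \<exists>y \<in> {v, c1, c2, c3, c4, a1, a2} - Q.
      x \<noteq> y \<and> {x, y} \<in> edges G - M"
    using not_weak_konig_egervaryD[OF simple not_weak_ke_u, of M Q, unfolded nbhd_u, OF assms(1-5)] .
  then obtain x y where "x \<in> {v, c1, c2, c3, c4, a1, a2} - Q" "y \<in> {v, c1, c2, c3, c4, a1, a2} - Q"
    "x \<noteq> y" "{x, y} \<in> edges G - M"
    by (elim bexE conjE) (rule that)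
  with assms(6) show False
    by blast
qed

text \<open>Irreducibility turns \<open>reducible_pairI\<close> into a refutation rule. Certificates
  are listed in the order \<open>Mu\<close>, \<open>Mv\<close>, \<open>T\<close>, \<open>Qu\<close>,
  \<open>Qv\<close>, \<open>F\<close>.\<close>

lemma packing:
  assumes "Mu \<subseteq> edges G" "\<Union>Mu \<subseteq> {c1, c2, c3, c4, a1, a2}" "pairwise disjnt Mu"
    and "Mv \<subseteq> edges G" "\<Union>Mv \<subseteq> {c1, c2, c3, c4, b1, b2}" "pairwise disjnt Mv"
    and "Mu \<inter> Mv = {}"
    and "T \<subseteq> {c1, c2, c3, c4}" "T \<inter> \<Union>(Mu \<union> Mv) = {}" "card T \<le> 1" "finite T"
    and "finite Qu" "finite Qv" "finite F"
    and "card Qu + card Qv + card Mu + card Mv + card F \<le> 2 * (card Mu + card Mv + card T)"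
    and "\<forall>x \<in> {c1, c2, c3, c4, a1, a2} - Qu. \<forall>y \<in> {c1, c2, c3, c4, a1, a2} - Qu.
      x \<noteq> y \<longrightarrow> {x, y} \<in> edges G \<longrightarrow> {x, y} \<in> Mu \<union> Mv \<union> F"
    and "\<forall>x \<in> {c1, c2, c3, c4, b1, b2} - Qv. \<forall>y \<in> {c1, c2, c3, c4, b1, b2} - Qv.
      x \<noteq> y \<longrightarrow> {x, y} \<in> edges G \<longrightarrow> {x, y} \<in> Mu \<union> Mv \<union> F"
    and "v \<in> Qu \<or> {c1, c2, c3, c4} \<subseteq> Qu \<union> Qv"
  shows False
proof -
  have "nbhd G u - {v} = {c1, c2, c3, c4, a1, a2}" "nbhd G v - {u} = {c1, c2, c3, c4, b1, b2}"
    "nbhd G u \<inter> nbhd G v = {c1, c2, c3, c4}"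
    by (auto simp: nbhd_u nbhd_v)
  moreover have "nbhd G u - insert v Qu = {c1, c2, c3, c4, a1, a2} - Qu"
      "nbhd G v - insert u Qv = {c1, c2, c3, c4, b1, b2} - Qv"
    by (auto simp: nbhd_u nbhd_v)
  moreover have "{u, v} \<in> edges G"
    by simp
  ultimately have "reducible G {u, v}"
    using assms by (intro reducible_pairI[OF simple, of u v Mu Mv T Qu Qv F]) simp_all
  then show False
    using irreducible by simp
qed

text \<open>Each \<open>c\<close> is already adjacent to \<open>u\<close> and \<open>v\<close>, so
  six further neighbours would give degree at least eight.\<close>

lemma degree:
  assumes "x \<in> {c1, c2, c3, c4}" "W \<subseteq> {c1, c2, c3, c4, a1, a2, b1, b2}" "card W = 6"
    and "\<And>y. y \<in> W \<Longrightarrow> {x, y} \<in> edges G"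
  shows False
proof -
  have "{u, v} \<union> W \<subseteq> nbhd G x"
    using assms by (auto simp: mem_nbhd_iff[OF simple])
  moreover have "x \<in> verts G"
    using assms(1) nbhd_u by (auto simp: nbhd_def)
  then have "card (nbhd G x) = 7"
    using seven_regular by (simp add: regular_def)
  moreover have "finite (nbhd G x)"
    using \<open>card (nbhd G x) = 7\<close> card.infinite by fastforce
  moreover have "u \<notin> W" "v \<notin> W" "finite W"
    using assms(2) by (auto intro: finite_subset)
  ultimately show False
    using card_mono[of "nbhd G x" "{u, v} \<union> W"] assms(3) by simp
qed

section \<open>Certificates for the constraints\<close>

text \<open>\<open>v\<close> is adjacent to neither \<open>a1\<close> nor \<open>a2\<close>, so a
  path in the link from \<open>v\<close> to \<open>a1\<close> must step from some \<open>c\<close>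
  to one of them. This is where connectedness enters.\<close>

lemma link_edge: "\<exists>x \<in> {c1, c2, c3, c4}. \<exists>y \<in> {a1, a2}. {x, y} \<in> edges G"
proof (rule ccontr)
  let ?R = "{(x, y). {x, y} \<in> edges (induced G (nbhd G u))}"
  assume none: "\<not> ?thesis"
  have "(v, a1) \<in> ?R\<^sup>*"
    using connected_u by (auto simp: connected_graph_def induced_def nbhd_u)
  then have "a1 \<in> {v, c1, c2, c3, c4}"
  proof induction
    case (step x y)
    then show ?case
      using none by (auto simp: induced_def nbhd_u)
  qed simp
  then show False
    by simp
qed

text \<open>Every matching contains an edge from \<open>v\<close> to some \<open>c\<close>, which is
  always present; the premise of the clause supplies its other edges. The conclusion lists the
  unmatched pairs avoiding \<open>Q\<close> that may still be edges, and \<open>Q\<close> is always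
  as large as \<open>M\<close>. The last clause is connectedness instead.\<close>

lemma forced_in_link: "forced_in_link (\<lambda>x y. {x, y} \<in> edges G) c1 c2 c3 c4 a1 a2"
  unfolding forced_in_link_def
  apply (intro conjI)
  subgoal
    by (rule ccontr, rule uncovered[of "{{v, c2}, {c3, c4}, {a1, a2}}" "{c1, c3, c4}"])
      (auto simp: certificate_simps)
  subgoal
    by (rule ccontr, rule uncovered[of "{{v, c4}, {c1, c2}, {c3, a1}}" "{c1, c2, c3}"])
      (auto simp: certificate_simps)
  subgoal
    by (rule ccontr, rule uncovered[of "{{v, c4}, {c1, a1}, {c3, a2}}" "{c1, c2, c3}"])
      (auto simp: certificate_simps)
  subgoal
    by (rule ccontr, rule uncovered[of "{{v, c2}, {c1, c4}, {c3, a1}}" "{v, c2, a2}"])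
      (auto simp: certificate_simps)
  subgoal
    by (rule ccontr, rule uncovered[of "{{v, c2}, {c1, c3}, {c4, a2}}" "{v, c2, a2}"])
      (auto simp: certificate_simps)
  subgoal
    by (rule ccontr, rule uncovered[of "{{v, c1}, {c3, a2}, {c4, a1}}" "{v, a1, a2}"])
      (auto simp: certificate_simps)
  subgoal
    by (rule ccontr, rule uncovered[of "{{v, c1}, {c2, a2}}" "{v, c4}"])
      (auto simp: certificate_simps)
  subgoal
    by (rule ccontr, rule uncovered[of "{{v, c1}, {a1, a2}}" "{v, c2}"])
      (auto simp: certificate_simps)
  subgoal
    by (rule ccontr, rule uncovered[of "{{v, c1}, {c3, a2}}" "{v, c3}"])
      (auto simp: certificate_simps)
  subgoal
    by (rule ccontr, rule uncovered[of "{{v, c1}, {c2, a1}}" "{v, a1}"])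
      (auto simp: certificate_simps)
  subgoal
    using link_edge by simp
  done

text \<open>After the two degree bounds, the premise of each clause supplies the edges of
  \<open>Mu\<close> and \<open>Mv\<close>, and the conclusion lists the pairs that the deletions
  would miss. Matching edges used at one endpoint are deleted for the link of the other as well.
  Every certificate exhausts the budget of two deletions per triangle.\<close>

lemma forced_in_pair: "forced_in_pair (\<lambda>x y. {x, y} \<in> edges G) c1 c2 c3 c4 a1 a2 b1 b2"
  unfolding forced_in_pair_def
  apply (intro conjI)
  subgoal
    by (rule notI, rule degree[of "c1" "{c2, c3, c4, a1, a2, b1}"])
      (auto simp: certificate_simps)
  subgoal
    by (rule notI, rule degree[of "c1" "{c2, c3, a1, a2, b1, b2}"])
      (auto simp: certificate_simps)
  \<comment> \<open>Each \<open>c\<close> lies in \<open>Qu\<close> or \<open>Qv\<close>, so every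
    triangle on \<open>uv\<close> is destroyed while \<open>uv\<close> itself stays.\<close>
  subgoal
    by (rule ccontr, rule packing[of "{{c2, a1}, {c3, a2}}" "{{c1, c2}, {c3, b1}}" "{c4}"
        "{c3, c4, a2}" "{c1, c2, b2}" "{}"])
      (auto simp: certificate_simps)
  \<comment> \<open>Here \<open>v\<close> in \<open>Qu\<close> deletes \<open>uv\<close> itself, and
    the one deletion left in the budget removes \<open>{c2, c4}\<close>, which is in neither
    matching.\<close>
  subgoal
    by (rule ccontr, rule packing[of "{{c1, c3}, {c4, a2}}" "{{c1, b1}, {c4, b2}}" "{c2}"
        "{v, a1, a2}" "{b1, b2}" "{{c2, c4}}"])
      (auto simp: certificate_simps)
  subgoal
    by (rule ccontr, rule packing[of "{{c1, a1}, {c2, c3}}" "{{c1, c2}, {c3, b2}}" "{c4}"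
        "{v, c4, a1}" "{c4, b1, b2}" "{}"])
      (auto simp: certificate_simps)
  subgoal
    by (rule ccontr, rule packing[of "{{c1, a2}, {c2, a1}, {c3, c4}}"
        "{{c1, c2}, {c3, b1}, {c4, b2}}" "{}"
        "{c3, c4, a2}" "{c1, c2, b1}" "{}"])
      (auto simp: certificate_simps)
  subgoal
    by (rule ccontr, rule packing[of "{{c1, c2}, {c3, c4}}" "{{c1, c3}, {c2, c4}, {b1, b2}}" "{}"
        "{v, a1, a2}" "{b1, b2}" "{}"])
      (auto simp: certificate_simps)
  subgoal
    by (rule ccontr, rule packing[of "{{c2, a2}, {c3, c4}}" "{{c2, c4}, {c3, b1}}" "{c1}"
        "{v, a1, a2}" "{b1, b2}" "{{c1, c4}}"])
      (auto simp: certificate_simps)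
  subgoal
    by (rule ccontr, rule packing[of "{{c2, a1}, {c3, c4}}" "{{c2, c4}, {c3, b1}}" "{c1}"
        "{v, c1, a1}" "{c1, b1}" "{{c2, c3}}"])
      (auto simp: certificate_simps)
  subgoal
    by (rule ccontr, rule packing[of "{{c2, c3}, {c4, a1}}" "{{c2, b1}, {c3, b2}}" "{c1}"
        "{c1, c2, c3, a2}" "{c1, c4}" "{}"])
      (auto simp: certificate_simps)
  subgoal
    by (rule ccontr, rule packing[of "{{c2, a1}, {c3, c4}}" "{{c2, c3}, {c4, b2}}" "{c1}"
        "{v, a1, a2}" "{b1, b2}" "{{c1, c2}}"])
      (auto simp: certificate_simps)
  subgoal
    by (rule ccontr, rule packing[of "{{c2, a2}, {c3, c4}}" "{{c2, c3}, {c4, b1}}" "{c1}"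
        "{v, c1, a2}" "{c1, b2}" "{{c2, c4}}"])
      (auto simp: certificate_simps)
  done

section \<open>Relabelling and the contradiction\<close>

text \<open>The hypotheses are symmetric in the two endpoints, so facts about the link of
  \<open>u\<close> carry over to that of \<open>v\<close>, with the \<open>b\<close>'s in place of
  the \<open>a\<close>'s.\<close>

lemma swap: "irreducible_edge G v u c1 c2 c3 c4 b1 b2 a1 a2"
proof
  show "distinct [v, u, c1, c2, c3, c4, b1, b2, a1, a2]"
    by simp
  show "\<not> reducible G {v, u}"
    using irreducible by (simp add: insert_commute)
qed (fact simple seven_regular nbhd_u nbhd_v connected_u connected_v not_weak_ke_u not_weak_ke_v)+

text \<open>Apart from distinctness of the labels, the hypotheses depend only on the sets of
  \<open>c\<close>'s, \<open>a\<close>'s and \<open>b\<close>'s. One certificate per clause thus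
  yields all its relabelled instances.\<close>

lemma permute:
  assumes C: "w \<in> {c1, c2, c3, c4}" "x \<in> {c1, c2, c3, c4} - {w}" "y \<in> {c1, c2, c3, c4} - {w, x}"
      "z \<in> {c1, c2, c3, c4} - {w, x, y}"
    and A: "p \<in> {a1, a2}" "q \<in> {a1, a2} - {p}"
    and B: "r \<in> {b1, b2}" "s \<in> {b1, b2} - {r}"
  shows "irreducible_edge G u v w x y z p q r s"
proof
  have dC: "distinct [w, x, y, z]"
    using DiffD2[OF C(2)] DiffD2[OF C(3)] DiffD2[OF C(4)] by auto
  \<comment> \<open>Four distinct elements of a four-element set exhaust it.\<close>
  have "set [w, x, y, z] = {c1, c2, c3, c4}"
  proof (rule card_subset_eq)
    show "card (set [w, x, y, z]) = card {c1, c2, c3, c4}"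
      using distinct_card[OF dC] by simp
  qed (use C in simp_all)
  moreover have "set [p, q] = {a1, a2}" "set [r, s] = {b1, b2}"
    using A B by auto
  ultimately have sets: "set [w, x, y, z] = {c1, c2, c3, c4}"
    "set [p, q] = {a1, a2}" "set [r, s] = {b1, b2}"
    by simp_all
  have "distinct ([u, v] @ [w, x, y, z] @ [p, q] @ [r, s])"
    unfolding distinct_append set_append sets using dC DiffD2[OF A(2)] DiffD2[OF B(2)] by auto
  then show "distinct [u, v, w, x, y, z, p, q, r, s]"
    by simp
  have "nbhd G u = set ([v] @ [w, x, y, z] @ [p, q])" "nbhd G v = set ([u] @ [w, x, y, z] @ [r, s])"
    unfolding nbhd_u nbhd_v set_append sets by (simp_all add: insert_commute)
  then show "nbhd G u = {v, w, x, y, z, p, q}" "nbhd G v = {u, w, x, y, z, r, s}"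
    by simp_all
qed (fact simple seven_regular connected_u connected_v not_weak_ke_u not_weak_ke_v irreducible)+

lemma contradiction: False
proof -
  let ?C = "{c1, c2, c3, c4}" and ?adj = "\<lambda>x y. {x, y} \<in> edges G"
  have link_a: "\<forall>w \<in> ?C. \<forall>x \<in> ?C - {w}. \<forall>y \<in> ?C - {w, x}. \<forall>z \<in> ?C - {w, x, y}.
      \<forall>p \<in> {a1, a2}. \<forall>q \<in> {a1, a2} - {p}. forced_in_link ?adj w x y z p q"
    by (intro ballI, rule irreducible_edge.forced_in_link[OF permute[of _ _ _ _ _ _ b1 b2]])
      (assumption | simp)+
  \<comment> \<open>Exchanging the endpoints after relabelling puts \<open>r\<close> and
    \<open>s\<close> in the roles of \<open>a1\<close> and \<open>a2\<close>.\<close>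
  have link_b: "\<forall>w \<in> ?C. \<forall>x \<in> ?C - {w}. \<forall>y \<in> ?C - {w, x}. \<forall>z \<in> ?C - {w, x, y}.
      \<forall>r \<in> {b1, b2}. \<forall>s \<in> {b1, b2} - {r}. forced_in_link ?adj w x y z r s"
    by (intro ballI,
        rule irreducible_edge.forced_in_link[OF irreducible_edge.swap[OF permute[of _ _ _ _ a1 a2]]])
      (assumption | simp)+
  have pair: "\<forall>w \<in> ?C. \<forall>x \<in> ?C - {w}. \<forall>y \<in> ?C - {w, x}. \<forall>z \<in> ?C - {w, x, y}.
      \<forall>p \<in> {a1, a2}. \<forall>q \<in> {a1, a2} - {p}. \<forall>r \<in> {b1, b2}. \<forall>s \<in> {b1, b2} - {r}.
      forced_in_pair ?adj w x y z p q r s \<and> forced_in_pair ?adj w x y z r s p q"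
    by (intro ballI conjI irreducible_edge.forced_in_pair[OF permute]
        irreducible_edge.forced_in_pair[OF irreducible_edge.swap[OF permute]])
  have "?adj x y \<longleftrightarrow> ?adj y x" for x y
    by (simp add: insert_commute)
  moreover have "distinct [c1, c2, c3, c4, a1, a2, b1, b2]"
    by simp
  ultimately show False
    using link_a link_b pair by (rule forced_adjacencies_inconsistent)
qed

end

section \<open>Labelling the two neighbourhoods\<close>

theorem proposition9p1:
  fixes G :: "'a graph" and u v :: 'a
  assumes "simple_graph G"
    and "regular 7 G"
    and "{u, v} \<in> edges G"
    and "card (nbhd G u \<inter> nbhd G v) = 4"
    and "connected_graph (induced G (nbhd G u))"
    and "connected_graph (induced G (nbhd G v))"
    and "\<not> weak_konig_egervary (induced G (nbhd G u))"
    and "\<not> weak_konig_egervary (induced G (nbhd G v))"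
  shows "reducible G {u, v}"
proof (rule ccontr)
  assume irreducible: "\<not> reducible G {u, v}"
  define C where "C = nbhd G u \<inter> nbhd G v"
  define A where "A = nbhd G u - insert v C"
  define B where "B = nbhd G v - insert u C"
  note nb = mem_nbhd_iff[OF assms(1)]
  have uv: "u \<in> verts G" "v \<in> verts G" "u \<noteq> v"
    using simple_graph_edgeD[OF assms(1,3)] by auto
  have "v \<in> nbhd G u" "u \<in> nbhd G v"
    using assms(3) by (simp_all add: nb insert_commute)
  then have nbhd: "nbhd G u = insert v (C \<union> A)" "nbhd G v = insert u (C \<union> B)"
    by (auto simp: A_def B_def C_def)
  have "u \<notin> nbhd G u" "v \<notin> nbhd G v"
    using simple_graph_edgeD(1)[OF assms(1), of u u] simple_graph_edgeD(1)[OF assms(1), of v v]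
    by (auto simp: nb)
  \<comment> \<open>A vertex in both \<open>A\<close> and \<open>B\<close> would be a common
    neighbour and hence lie in \<open>C\<close>.\<close>
  then have disjoint: "u \<notin> C \<union> A \<union> B" "v \<notin> C \<union> A \<union> B" "C \<inter> A = {}" "C \<inter> B = {}" "A \<inter> B = {}"
    by (auto simp: A_def B_def C_def)
  have card_C: "card C = 4"
    using assms(4) by (simp add: C_def)
  have card: "card (nbhd G u) = 7" "card (nbhd G v) = 7"
    using assms(2) uv by (simp_all add: regular_def)
  then have fin: "finite (nbhd G u)" "finite (nbhd G v)"
    by (simp_all add: card_ge_0_finite)
  then have "finite C" "finite A" "finite B"
    by (simp_all add: A_def B_def C_def)
  \<comment> \<open>Besides the other endpoint and the four vertices of \<open>C\<close>, each
    neighbourhood has 7 - 1 - 4 = 2 vertices.\<close>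
  then have "card A = 2" "card B = 2"
    using card card_C disjoint by (simp_all add: nbhd card_Un_disjoint)
  then obtain a1 a2 b1 b2 where A: "A = {a1, a2}" "a1 \<noteq> a2" and B: "B = {b1, b2}" "b1 \<noteq> b2"
    unfolding card_2_iff by (elim exE conjE) (rule that)
  obtain xs where xs: "set xs = C" "distinct xs"
    using finite_distinct_list[OF \<open>finite C\<close>] by metis
  then have "length xs = 4"
    using card_C distinct_card by metis
  then obtain c1 c2 c3 c4 where "xs = [c1, c2, c3, c4]"
    by (auto simp: numeral_eq_Suc length_Suc_conv)
  with xs have C: "C = {c1, c2, c3, c4}" "distinct [c1, c2, c3, c4]"
    by auto
  have nbhd': "nbhd G u = {v, c1, c2, c3, c4, a1, a2}" "nbhd G v = {u, c1, c2, c3, c4, b1, b2}"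
    unfolding nbhd A B C by (simp_all add: insert_commute)
  have "distinct [u, v, c1, c2, c3, c4, a1, a2, b1, b2]"
    using uv(3) A(2) B(2) C(2) disjoint unfolding A(1) B(1) C(1) by auto
  then have "irreducible_edge G u v c1 c2 c3 c4 a1 a2 b1 b2"
    using assms nbhd' irreducible by (intro irreducible_edge.intro)
  then show False
    by (rule irreducible_edge.contradiction)
qed

end
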